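(* Let $\mathbb{H}$ be a complex Hilbert space and let $T \in B(\mathbb{H})$ be a bounded linear operator. Then for every $\lambda \in (0,1)$, $T$ is quasi-hyperbolic if and only if its $\lambda$-Aluthge transform $\Delta_\lambda(T)$ is quasi-hyperbolic.
   Context: $B(\mathbb{H})$ denotes the algebra of bounded linear operators on $\mathbb{H}$. For $T \in B(\mathbb{H})$, $|T| = (T^*T)^{1/2}$, and the polar decomposition $T = U|T|$ is the unique one in which $U$ is a partial isometry with $\ker U = \ker |T| = \ker T$. For $\lambda \in (0,1)$, the $\lambda$-Aluthge transform of $T$ is $\Delta_\lambda(T) = |T|^{\lambda} U |T|^{1-\lambda}$. An operator $S \in B(\mathbb{H})$ (not assumed invertible) is quasi-hyperbolic if there exists a positive integer $n$, independent of $x$, such that $\max(\|S^{2n}x\|, \|x\|) \ge 2\|S^n x\|$ for all $x \in \mathbb{H}$. *)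

theory Defs
  imports "HOL-Analysis.Analysis" "HOL-Computational_Algebra.Polynomial"
begin

text \<open>
  Complex inner product spaces. The real structure on which the library's norm, topology and
  bounded operators rest is the underlying one: real scalars act as complex scalars and the real
  inner product is the real part of the complex one. The inner product is linear in its first
  argument.
\<close>

class complex_inner = real_inner +
  fixes scaleC :: "complex \<Rightarrow> 'a \<Rightarrow> 'a"  (infixr "*\<^sub>C" 75)
    and cinner :: "'a \<Rightarrow> 'a \<Rightarrow> complex"
  assumes scaleC_add_right: "c *\<^sub>C (x + y) = c *\<^sub>C x + c *\<^sub>C y"
    and scaleC_add_left: "(c + d) *\<^sub>C x = c *\<^sub>C x + d *\<^sub>C x"
    and scaleC_scaleC: "c *\<^sub>C (d *\<^sub>C x) = (c * d) *\<^sub>C x"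
    and scaleC_of_real: "complex_of_real r *\<^sub>C x = r *\<^sub>R x"
    and cinner_commute: "cinner x y = cnj (cinner y x)"
    and cinner_add_left: "cinner (x + y) z = cinner x z + cinner y z"
    and cinner_scaleC_left: "cinner (c *\<^sub>C x) y = c * cinner x y"
    and inner_eq_Re_cinner: "inner x y = Re (cinner x y)"

class chilbert_space = complex_inner + complete_space

instantiation complex :: chilbert_space
begin

definition scaleC_complex :: "complex \<Rightarrow> complex \<Rightarrow> complex"
  where "scaleC_complex c x = c * x"

definition cinner_complex :: "complex \<Rightarrow> complex \<Rightarrow> complex"
  where "cinner_complex x y = x * cnj y"

instance
  by standard
    (simp_all add: scaleC_complex_def cinner_complex_def algebra_simps scaleR_conv_of_real
      inner_complex_def)

end

text \<open>
  The type of bounded linear maps of the library is over the reals. The algebra of bounded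
  operators on a complex Hilbert space consists of its elements that are complex linear.
\<close>

definition complex_linear :: "('a::complex_inner \<Rightarrow>\<^sub>L 'a) \<Rightarrow> bool"
  where "complex_linear T \<longleftrightarrow> (\<forall>c x. T (c *\<^sub>C x) = c *\<^sub>C T x)"

definition op_pow :: "('a::real_normed_vector \<Rightarrow>\<^sub>L 'a) \<Rightarrow> nat \<Rightarrow> ('a \<Rightarrow>\<^sub>L 'a)"
  where "op_pow T n = (((o\<^sub>L) T) ^^ n) id_blinfun"

definition op_poly :: "real poly \<Rightarrow> ('a::real_normed_vector \<Rightarrow>\<^sub>L 'a) \<Rightarrow> ('a \<Rightarrow>\<^sub>L 'a)"
  where "op_poly p T = (\<Sum>i\<le>degree p. coeff p i *\<^sub>R op_pow T i)"

definition op_ker :: "('a::real_normed_vector \<Rightarrow>\<^sub>L 'a) \<Rightarrow> 'a set"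
  where "op_ker T = {x. T x = 0}"

definition cadjoint :: "('a::chilbert_space \<Rightarrow>\<^sub>L 'a) \<Rightarrow> ('a \<Rightarrow>\<^sub>L 'a)"
  where "cadjoint T = (THE S :: 'a \<Rightarrow>\<^sub>L 'a. \<forall>x y. cinner (T x) y = cinner x (S y))"

definition spectrum :: "('a::chilbert_space \<Rightarrow>\<^sub>L 'a) \<Rightarrow> complex set"
  where "spectrum T =
    {z. \<not> (\<exists>S :: 'a \<Rightarrow>\<^sub>L 'a. complex_linear S \<and>
          (\<forall>x. T (S x) - z *\<^sub>C S x = x) \<and> (\<forall>x. S (T x - z *\<^sub>C x) = x))}"

text \<open>
  Continuous functional calculus of a self-adjoint operator (whose spectrum is real) for a
  real-valued function that is continuous on the spectrum: the operator-norm limit of the values of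
  any real polynomials that converge uniformly on the spectrum to the function. It is meaningful
  only under these hypotheses.
\<close>

definition cont_fun_calc ::
    "(real \<Rightarrow> real) \<Rightarrow> ('a::chilbert_space \<Rightarrow>\<^sub>L 'a) \<Rightarrow> ('a \<Rightarrow>\<^sub>L 'a)"
  where "cont_fun_calc f A =
    (THE B. \<forall>p :: nat \<Rightarrow> real poly.
       uniform_limit {t. complex_of_real t \<in> spectrum A} (\<lambda>n t. poly (p n) t) f sequentially
       \<longrightarrow> (\<lambda>n. op_poly (p n) A) \<longlonglongrightarrow> B)"

text \<open>
  Powers of a positive operator, for exponents \<open>r > 0\<close>; there \<open>0 powr r = 0\<close>, so the function is
  continuous on the spectrum.
\<close>

definition op_powr :: "('a::chilbert_space \<Rightarrow>\<^sub>L 'a) \<Rightarrow> real \<Rightarrow> ('a \<Rightarrow>\<^sub>L 'a)"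
  where "op_powr A r = cont_fun_calc (\<lambda>t. t powr r) A"

definition op_abs :: "('a::chilbert_space \<Rightarrow>\<^sub>L 'a) \<Rightarrow> ('a \<Rightarrow>\<^sub>L 'a)"
  where "op_abs T = op_powr (cadjoint T o\<^sub>L T) (1/2)"

definition partial_isometry :: "('a::chilbert_space \<Rightarrow>\<^sub>L 'a) \<Rightarrow> bool"
  where "partial_isometry U \<longleftrightarrow>
    (\<forall>x. (\<forall>y\<in>op_ker U. cinner x y = 0) \<longrightarrow> norm (U x) = norm x)"

definition polar_part :: "('a::chilbert_space \<Rightarrow>\<^sub>L 'a) \<Rightarrow> ('a \<Rightarrow>\<^sub>L 'a)"
  where "polar_part T =
    (THE U :: 'a \<Rightarrow>\<^sub>L 'a. complex_linear U \<and> partial_isometry U \<and> T = U o\<^sub>L op_abs T \<and>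
       op_ker U = op_ker (op_abs T) \<and> op_ker (op_abs T) = op_ker T)"

definition aluthge :: "real \<Rightarrow> ('a::chilbert_space \<Rightarrow>\<^sub>L 'a) \<Rightarrow> ('a \<Rightarrow>\<^sub>L 'a)"
  where "aluthge l T =
    op_powr (op_abs T) l o\<^sub>L polar_part T o\<^sub>L op_powr (op_abs T) (1 - l)"

definition quasi_hyperbolic :: "('a::chilbert_space \<Rightarrow>\<^sub>L 'a) \<Rightarrow> bool"
  where "quasi_hyperbolic S \<longleftrightarrow>
    (\<exists>n::nat. n > 0 \<and>
       (\<forall>x. max (norm (op_pow S (2 * n) x)) (norm x) \<ge> 2 * norm (op_pow S n x)))"

end

theory Submission
  imports Defs "HOL-Computational_Algebra.Fundamental_Theorem_Algebra"
begin

text \<open>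
  Put \<open>A = |T|\<^sup>l\<close> and \<open>B = U |T|\<^sup>1\<^sup>-\<^sup>l\<close>, where \<open>U\<close> is the polar part of \<open>T\<close>. Then \<open>T = B A\<close>, and the
  Aluthge transform is \<open>A B\<close>. The theorem is therefore an instance of the general fact
  \<open>quasi_hyperbolic_swap\<close>: quasi-hyperbolicity passes from \<open>B A\<close> to \<open>A B\<close> for any bounded \<open>A\<close> and
  \<open>B\<close>. The reason is that the defining inequality forces every orbit, sampled at the multiples of
  \<open>n\<close>, to double for ever from any given point on or to have at least halved in each step up to that
  point (\<open>doubling_dichotomy\<close>). The norms along the \<open>A B\<close>-orbit of \<open>x\<close> and the \<open>B A\<close>-orbit of \<open>B x\<close>
  bound each other up to constant factors and a bounded shift of the index, and a large power of two
  beats these constants.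

  The other half of the work is to show that \<open>|T|\<close>, its powers and \<open>U\<close>, which are introduced by
  definite descriptions, exist and satisfy \<open>|T|\<^sup>1\<^sup>-\<^sup>l |T|\<^sup>l = |T|\<close> and \<open>T = U |T|\<close>. For the powers
  everything rests on the bound of \<open>norm (p(A))\<close>, for self-adjoint \<open>A\<close> and a real polynomial \<open>p\<close>, by
  the supremum of \<open>|p|\<close> on the real spectrum (\<open>op_poly_norm_le\<close>). Let \<open>p\<close> be nonconstant and the
  space nontrivial. With \<open>N = norm (p(A))\<close>, the operator
  \<open>p(A)\<^sup>2 - N\<^sup>2\<close> is not bounded below. Factoring \<open>p\<^sup>2 - N\<^sup>2\<close> over the reals, one of the factors is not
  bounded below at \<open>A\<close>, and it must be a linear one: its zero lies in the spectrum, and \<open>|p| = N\<close>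
  there. The functional calculus is then a limit in operator norm and multiplicative. The polar part
  is obtained by extending the isometry \<open>|T| v \<mapsto> T v\<close> to the closure of the range of \<open>|T|\<close> and by zero
  to the orthogonal complement, which is \<open>ker |T|\<close>.
\<close>

section \<open>Quasi-hyperbolicity of products\<close>

lemma op_pow_0 [simp]: "op_pow T 0 = id_blinfun"
  by (simp add: op_pow_def)

lemma op_pow_Suc: "op_pow T (Suc n) = T o\<^sub>L op_pow T n"
  by (simp add: op_pow_def)

lemma op_pow_add_apply: "op_pow T (m + n) x = op_pow T m (op_pow T n x)"
  by (induction m) (simp_all add: op_pow_Suc)

text \<open>
  Doubling is hereditary: if the term doubles at \<open>j\<close>, then the alternative \<open>2 * b (j + 1) \<le> b j\<close> can
  only hold when both terms vanish, so the term doubles at \<open>j + 1\<close>. Hence doubling either starts at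
  or before \<open>k\<close> and lasts for ever, or has never occurred up to \<open>k\<close>, and then the sequence has at
  least halved in each step on the way to \<open>k\<close>.
\<close>

lemma doubling_dichotomy:
  fixes b :: "nat \<Rightarrow> real"
  assumes nonneg: "\<And>k. 0 \<le> b k"
    and step: "\<And>k. 2 * b (Suc k) \<le> max (b (Suc (Suc k))) (b k)"
  shows "(\<forall>p. 2 ^ p * b k \<le> b (k + p)) \<or> (\<forall>p\<le>k. 2 ^ p * b k \<le> b (k - p))"
proof (cases "2 * b k \<le> b (Suc k)")
  case True
  have dbl: "2 * b (k + p) \<le> b (Suc (k + p))" for p
  proof (induction p)
    case 0
    show ?case using True by simp
  next
    case (Suc p)
    show ?case
      using step[of "k + p"] Suc nonneg[of "Suc (Suc (k + p))"] by (auto simp: max_def split: if_splits)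
  qed
  have "2 ^ p * b k \<le> b (k + p)" for p
  proof (induction p)
    case (Suc p)
    then show ?case using dbl[of p] by simp
  qed simp
  then show ?thesis by blast
next
  case False
  have no_dbl: "\<not> 2 * b (k - p) \<le> b (Suc (k - p))" for p
  proof (induction p)
    case 0
    show ?case using False by simp
  next
    case (Suc p)
    show ?case
    proof (cases "p < k")
      case True
      then have e: "k - p = Suc (k - Suc p)" by simp
      show ?thesis
        using Suc step[of "k - Suc p"] nonneg[of "Suc (Suc (k - Suc p))"] unfolding e
        by (auto simp: max_def split: if_splits)
    next
      case False
      then have "k - Suc p = k - p" by simp
      with Suc show ?thesis by simp
    qed
  qed
  have "p \<le> k \<Longrightarrow> 2 ^ p * b k \<le> b (k - p)" for p
  proof (induction p)
    case (Suc p)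
    then have e: "k - p = Suc (k - Suc p)" by simp
    have "2 * b (k - p) \<le> b (k - Suc p)"
      using no_dbl[of p] step[of "k - Suc p"] unfolding e by (auto simp: max_def split: if_splits)
    with Suc show ?case by simp
  qed simp
  then show ?thesis by blast
qed

text \<open>
  With \<open>T = B o\<^sub>L A\<close> and \<open>S = A o\<^sub>L B\<close> the relations \<open>B S\<^sup>k = T\<^sup>k B\<close> and \<open>S\<^sup>k\<^sup>+\<^sup>1 = A T\<^sup>k B\<close> bound the
  \<open>S\<close>-orbit of \<open>x\<close> and the \<open>T\<close>-orbit of \<open>B x\<close> in terms of each other, with constants that do not
  depend on \<open>x\<close> or on the length of the orbits. The dichotomy makes the \<open>T\<close>-orbit grow or decay
  geometrically, which absorbs these constants once \<open>n\<close> is replaced by a large multiple.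
\<close>

proposition quasi_hyperbolic_swap:
  fixes A B :: "'a::chilbert_space \<Rightarrow>\<^sub>L 'a"
  assumes "quasi_hyperbolic (B o\<^sub>L A)"
  shows "quasi_hyperbolic (A o\<^sub>L B)"
proof -
  define T where "T = B o\<^sub>L A"
  define S where "S = A o\<^sub>L B"
  obtain n where n: "n > 0"
    and qh: "\<And>x. 2 * norm (op_pow T n x) \<le> max (norm (op_pow T (2 * n) x)) (norm x)"
    using assms unfolding quasi_hyperbolic_def T_def by auto
  have BS: "B (op_pow S k x) = op_pow T k (B x)" for k x
    by (induction k) (simp_all add: op_pow_Suc S_def T_def)
  have AT: "op_pow S (Suc k) x = A (op_pow T k (B x))" for k x
    using BS[of k x] by (simp add: op_pow_Suc S_def)
  define C where "C = norm (A o\<^sub>L op_pow T (n - 1))"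
  define D where "D = norm B + 1"
  have "C \<ge> 0" "D > 0" by (simp_all add: C_def D_def add_nonneg_pos)
  obtain m :: nat where m: "2 * C * D < 2 ^ m"
    using real_arch_pow[of 2 "2 * C * D"] by auto
  have "2 * norm (op_pow S (n * Suc m) x) \<le> max (norm (op_pow S (2 * (n * Suc m)) x)) (norm x)" for x
  proof -
    define a where "a k = norm (op_pow S (n * k) x)" for k
    define b where "b k = norm (op_pow T (n * k) (B x))" for k
    have b0: "0 \<le> b k" for k by (simp add: b_def)
    have b_le: "b k \<le> D * a k" for k
    proof -
      have "b k \<le> norm B * a k"
        unfolding a_def b_def BS[symmetric] by (rule norm_blinfun)
      also have "\<dots> \<le> D * a k" by (simp add: D_def a_def mult_right_mono)
      finally show ?thesis .
    qed
    have a_le: "a (Suc k) \<le> C * b k" for k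
    proof -
      have "op_pow S (n * Suc k) x = op_pow S (Suc ((n - 1) + n * k)) x"
        using n by simp
      also have "\<dots> = (A o\<^sub>L op_pow T (n - 1)) (op_pow T (n * k) (B x))"
        unfolding AT by (simp add: op_pow_add_apply)
      finally show ?thesis
        unfolding a_def b_def C_def by (simp only: norm_blinfun)
    qed
    have step: "2 * b (Suc k) \<le> max (b (Suc (Suc k))) (b k)" for k
    proof -
      have e1: "op_pow T (n * Suc k) (B x) = op_pow T n (op_pow T (n * k) (B x))"
        by (simp add: op_pow_add_apply)
      have "n * Suc (Suc k) = 2 * n + n * k" by simp
      then have e2: "op_pow T (n * Suc (Suc k)) (B x) = op_pow T (2 * n) (op_pow T (n * k) (B x))"
        by (simp only: op_pow_add_apply)
      show ?thesis unfolding b_def e1 e2 by (rule qh)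
    qed
    \<comment> \<open>The bound on the \<open>S\<close>-orbit at \<open>Suc m\<close> involves the \<open>T\<close>-orbit at \<open>m\<close>, one step earlier. A growing
      \<open>T\<close>-orbit makes up for this shift, as it goes on growing up to \<open>2 * Suc m\<close>.\<close>
    have "2 ^ m * b m \<le> b (2 * Suc m) \<or> 2 ^ m * b m \<le> b 0"
    proof -
      consider "2 ^ (m + 2) * b m \<le> b (m + (m + 2))" | "2 ^ m * b m \<le> b (m - m)"
        using doubling_dichotomy[of b m, OF b0 step] by blast
      then show ?thesis
      proof cases
        case 1
        have "2 ^ m * b m \<le> 2 ^ (m + 2) * b m"
          using b0[of m] by (intro mult_right_mono power_increasing) auto
        also note 1
        also have "m + (m + 2) = 2 * Suc m" by simp
        finally show ?thesis ..
      next
        case 2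
        then show ?thesis by simp
      qed
    qed
    then have "2 ^ m * b m \<le> D * max (a (2 * Suc m)) (a 0)"
    proof
      assume "2 ^ m * b m \<le> b (2 * Suc m)"
      also have "\<dots> \<le> D * a (2 * Suc m)" by (rule b_le)
      also have "\<dots> \<le> D * max (a (2 * Suc m)) (a 0)" using \<open>D > 0\<close> by simp
      finally show ?thesis .
    next
      assume "2 ^ m * b m \<le> b 0"
      also have "\<dots> \<le> D * a 0" by (rule b_le)
      also have "\<dots> \<le> D * max (a (2 * Suc m)) (a 0)" using \<open>D > 0\<close> by simp
      finally show ?thesis .
    qed
    moreover have "D * (2 * a (Suc m)) \<le> 2 ^ m * b m"
    proof -
      have "D * (2 * a (Suc m)) \<le> D * (2 * (C * b m))"
        using a_le[of m] \<open>D > 0\<close> by simp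
      also have "\<dots> = (2 * C * D) * b m" by simp
      also have "\<dots> \<le> 2 ^ m * b m" using m b0[of m] by (intro mult_right_mono) auto
      finally show ?thesis .
    qed
    ultimately have "D * (2 * a (Suc m)) \<le> D * max (a (2 * Suc m)) (a 0)" by linarith
    then have "2 * a (Suc m) \<le> max (a (2 * Suc m)) (a 0)" using \<open>D > 0\<close> by simp
    moreover have "a (2 * Suc m) = norm (op_pow S (2 * (n * Suc m)) x)"
      by (simp only: a_def mult.left_commute)
    ultimately show ?thesis by (simp add: a_def)
  qed
  then show ?thesis
    unfolding quasi_hyperbolic_def S_def[symmetric]
    by (intro exI[of _ "n * Suc m"]) (use n in auto)
qed

section \<open>Operators on Hilbert spaces\<close>

lemma exists_orthogonal_projection:
  fixes M :: "'a::{real_inner, complete_space} set"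
  assumes "subspace M" "closed M"
  obtains a where "a \<in> M" "\<And>m. m \<in> M \<Longrightarrow> inner (x - a) m = 0"
proof -
  define d where "d = infdist x M"
  have "M \<noteq> {}" using assms(1) subspace_0 by blast
  have d_le: "d \<le> norm (x - m)" if "m \<in> M" for m
    using infdist_le[OF that, of x] by (simp add: d_def dist_norm)
  have "d \<ge> 0" by (simp add: d_def infdist_nonneg)
  have near: "\<exists>m\<in>M. (norm (x - m))\<^sup>2 < d\<^sup>2 + e" if "e > 0" for e
  proof -
    have "d < sqrt (d\<^sup>2 + e)"
      using \<open>d \<ge> 0\<close> that by (intro real_less_rsqrt) simp
    then have "(INF a\<in>M. dist x a) < sqrt (d\<^sup>2 + e)"
      by (simp add: d_def infdist_notempty[OF \<open>M \<noteq> {}\<close>])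
    then obtain m where m: "m \<in> M" "dist x m < sqrt (d\<^sup>2 + e)"
      using cInf_lessD[of "dist x ` M"] \<open>M \<noteq> {}\<close> by auto
    have "(norm (x - m))\<^sup>2 < (sqrt (d\<^sup>2 + e))\<^sup>2"
      using m(2) by (intro power_strict_mono) (auto simp: dist_norm)
    then show ?thesis using m(1) that by auto
  qed
  obtain s where s: "\<And>n. s n \<in> M" "\<And>n. (norm (x - s n))\<^sup>2 < d\<^sup>2 + inverse (real (Suc n))"
    using near[of "inverse (real (Suc _))"] by (metis inverse_positive_iff_positive of_nat_0_less_iff zero_less_Suc)
  \<comment> \<open>The parallelogram law makes every minimizing sequence a Cauchy sequence.\<close>
  have par: "(norm (s i - s j))\<^sup>2 \<le> 2 * inverse (real (Suc i)) + 2 * inverse (real (Suc j))" for i j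
  proof -
    have "(1/2) *\<^sub>R (s i + s j) \<in> M"
      using s(1) assms(1) by (intro subspace_scale subspace_add)
    from d_le[OF this] \<open>d \<ge> 0\<close> have "d\<^sup>2 \<le> (norm (x - (1/2) *\<^sub>R (s i + s j)))\<^sup>2"
      by (intro power_mono)
    moreover have "(norm (s i - s j))\<^sup>2 = 2 * (norm (x - s i))\<^sup>2 + 2 * (norm (x - s j))\<^sup>2
        - 4 * (norm (x - (1/2) *\<^sub>R (s i + s j)))\<^sup>2"
      by (simp add: power2_norm_eq_inner inner_diff_left inner_diff_right inner_add_left
          inner_add_right inner_commute field_simps)
    ultimately show ?thesis using s(2)[of i] s(2)[of j] by linarith
  qed
  have "Cauchy s"
  proof (rule CauchyI)
    fix e :: real assume "e > 0"
    then obtain N where N: "inverse (real (Suc N)) < e\<^sup>2 / 4"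
      using reals_Archimedean[of "e\<^sup>2 / 4"] by auto
    have "norm (s i - s j) < e" if "i \<ge> N" "j \<ge> N" for i j
    proof -
      have "inverse (real (Suc i)) \<le> inverse (real (Suc N))" "inverse (real (Suc j)) \<le> inverse (real (Suc N))"
        using that by (auto intro!: le_imp_inverse_le)
      then have "(norm (s i - s j))\<^sup>2 < e\<^sup>2" using par[of i j] N by linarith
      then show ?thesis using \<open>e > 0\<close> by (simp add: power2_less_imp_less)
    qed
    then show "\<exists>N. \<forall>i\<ge>N. \<forall>j\<ge>N. norm (s i - s j) < e" by blast
  qed
  then obtain a where a: "s \<longlonglongrightarrow> a"
    by (metis Cauchy_convergent_iff convergent_def)
  have "a \<in> M" using closed_sequentially[OF assms(2)] s(1) a by blast
  have "(\<lambda>n. d\<^sup>2 + inverse (real (Suc n))) \<longlonglongrightarrow> d\<^sup>2 + 0"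
    by (intro tendsto_intros LIMSEQ_inverse_real_of_nat)
  moreover have "(\<lambda>n. (norm (x - s n))\<^sup>2) \<longlonglongrightarrow> (norm (x - a))\<^sup>2"
    by (intro tendsto_intros a)
  ultimately have le: "(norm (x - a))\<^sup>2 \<le> d\<^sup>2"
    using s(2) by (intro LIMSEQ_le[of _ _ "\<lambda>n. d\<^sup>2 + inverse (real (Suc n))"]) (auto intro: less_imp_le)
  have "inner (x - a) m = 0" if "m \<in> M" for m
  proof (cases "m = 0")
    case False
    define t where "t = inner (x - a) m / inner m m"
    have mm: "inner m m > 0" using False by simp
    have "a + t *\<^sub>R m \<in> M" using \<open>a \<in> M\<close> that assms(1) by (intro subspace_add subspace_scale)
    from d_le[OF this] \<open>d \<ge> 0\<close> have "d\<^sup>2 \<le> (norm (x - (a + t *\<^sub>R m)))\<^sup>2"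
      by (intro power_mono)
    also have "\<dots> = (norm (x - a))\<^sup>2 - 2 * t * inner (x - a) m + t\<^sup>2 * inner m m"
      by (simp add: power2_norm_eq_inner inner_diff_left inner_diff_right inner_add_left
          inner_add_right inner_commute) (simp add: power2_eq_square algebra_simps)
    also have "\<dots> = (norm (x - a))\<^sup>2 - (inner (x - a) m)\<^sup>2 / inner m m"
      using mm by (simp add: t_def power2_eq_square field_simps)
    finally have "(inner (x - a) m)\<^sup>2 / inner m m \<le> 0" using le by linarith
    then have "(inner (x - a) m)\<^sup>2 \<le> 0" using mm by (simp add: divide_le_0_iff)
    then show ?thesis by simp
  qed simp
  with \<open>a \<in> M\<close> show thesis using that by blast
qed

lemma riesz_representation:
  fixes f :: "'a::{real_inner, complete_space} \<Rightarrow> real"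
  assumes "bounded_linear f"
  obtains z where "\<And>x. f x = inner x z"
proof (cases "\<forall>x. f x = 0")
  case True
  then show thesis using that[of 0] by simp
next
  case False
  interpret bounded_linear f by fact
  obtain x where x: "f x \<noteq> 0" using False by blast
  have "closed (f -` {0})"
    using linear_continuous_on[OF assms] by (intro closed_vimage) auto
  moreover have "subspace (f -` {0})"
    by (rule subspaceI) (auto simp: zero add scaleR)
  ultimately obtain a where a: "f a = 0" and ort: "\<And>m. f m = 0 \<Longrightarrow> inner (x - a) m = 0"
    using exists_orthogonal_projection[of "f -` {0}" x] by (auto simp: vimage_def)
  define w where "w = x - a"
  have fw: "f w \<noteq> 0" using x a by (simp add: w_def diff)
  then have ww: "inner w w \<noteq> 0" using zero by auto
  have "f y = inner y ((f w / inner w w) *\<^sub>R w)" for y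
  proof -
    have "f (y - (f y / f w) *\<^sub>R w) = 0" using fw by (simp add: diff scaleR)
    then have "inner w (y - (f y / f w) *\<^sub>R w) = 0" unfolding w_def by (rule ort)
    then have "inner w y = (f y / f w) * inner w w" by (simp add: inner_diff_right)
    then show ?thesis using fw ww by (simp add: inner_commute)
  qed
  then show thesis using that by blast
qed

text \<open>
  Adjoints, inverses and the polar part all arise from their graphs. The bound at \<open>x = 0\<close> makes the
  graph single-valued, and the values depend linearly on \<open>x\<close> because the graph is a subspace.
\<close>

lemma blinfun_of_graph:
  fixes G :: "('a::real_normed_vector \<times> 'b::real_normed_vector) set"
  assumes "subspace G" and total: "\<And>x. \<exists>y. (x, y) \<in> G"
    and bound: "\<And>x y. (x, y) \<in> G \<Longrightarrow> norm y \<le> C * norm x"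
  obtains S :: "'a \<Rightarrow>\<^sub>L 'b" where "\<And>x y. (x, y) \<in> G \<longleftrightarrow> S x = y"
proof -
  obtain f where f: "\<And>x. (x, f x) \<in> G" using total by metis
  have uniq: "y = f x" if "(x, y) \<in> G" for x y
  proof -
    have "(x, y) - (x, f x) \<in> G" by (rule subspace_diff[OF assms(1) that f])
    then have "(0, y - f x) \<in> G" by simp
    from bound[OF this] show ?thesis by simp
  qed
  have "bounded_linear f"
  proof (rule bounded_linear_intro[where K = C])
    show "f (x + y) = f x + f y" for x y
      using subspace_add[OF assms(1) f f, of x y] uniq by fastforce
    show "f (r *\<^sub>R x) = r *\<^sub>R f x" for r x
      using subspace_scale[OF assms(1) f, of r x] uniq by fastforce
    show "norm (f x) \<le> norm x * C" for x
      using bound[OF f] by (simp add: mult.commute)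
  qed
  then have "(x, y) \<in> G \<longleftrightarrow> Blinfun f x = y" for x y
    using f uniq by (auto simp: bounded_linear_Blinfun_apply)
  then show thesis using that by blast
qed

definition self_adjoint :: "('a::real_inner \<Rightarrow>\<^sub>L 'a) \<Rightarrow> bool"
  where "self_adjoint A \<longleftrightarrow> (\<forall>x y. inner (A x) y = inner x (A y))"

definition bounded_below :: "('a::real_normed_vector \<Rightarrow>\<^sub>L 'a) \<Rightarrow> bool"
  where "bounded_below A \<longleftrightarrow> (\<exists>c>0. \<forall>x. c * norm x \<le> norm (A x))"

lemma bounded_below_compose:
  assumes "bounded_below A" "bounded_below B"
  shows "bounded_below (A o\<^sub>L B)"
proof -
  obtain c d where c: "c > 0" "\<And>x. c * norm x \<le> norm (A x)"
    and d: "d > 0" "\<And>x. d * norm x \<le> norm (B x)"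
    using assms unfolding bounded_below_def by blast
  have "(c * d) * norm x \<le> norm (A (B x))" for x
  proof -
    have "(c * d) * norm x \<le> c * norm (B x)" using c(1) d(2)[of x] by (simp add: mult.assoc)
    also have "\<dots> \<le> norm (A (B x))" by (rule c(2))
    finally show ?thesis .
  qed
  then show ?thesis
    unfolding bounded_below_def using c(1) d(1) by (intro exI[of _ "c * d"]) simp
qed

text \<open>
  The lower bound makes the range closed. The residual \<open>y - a\<close> of the projection to the range is
  annihilated by \<open>A\<close>, since \<open>A (A (y - a))\<close> is in the range, so it vanishes by the lower bound.
\<close>

lemma self_adjoint_bounded_below_imp_surj:
  fixes A :: "'a::{real_inner, complete_space} \<Rightarrow>\<^sub>L 'a"
  assumes sa: "self_adjoint A" and bb: "bounded_below A"
  shows "surj (blinfun_apply A)"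
proof -
  obtain c where c: "c > 0" "\<And>x. c * norm x \<le> norm (A x)"
    using bb unfolding bounded_below_def by blast
  have "complete (range (blinfun_apply A))"
    using c complete_isometric_image[OF \<open>c > 0\<close> subspace_UNIV, of A]
    by (simp add: blinfun.bounded_linear_right complete_UNIV mult.commute)
  then have cl: "closed (range (blinfun_apply A))" by (rule complete_imp_closed)
  have sub: "subspace (range (blinfun_apply A))"
    by (intro linear_subspace_image subspace_UNIV bounded_linear.linear blinfun.bounded_linear_right)
  have "y \<in> range (blinfun_apply A)" for y
  proof -
    obtain a where a: "a \<in> range (blinfun_apply A)"
      and ort: "\<And>m. m \<in> range (blinfun_apply A) \<Longrightarrow> inner (y - a) m = 0"
      using exists_orthogonal_projection[OF sub cl] by metis
    have "inner (A (y - a)) (A (y - a)) = 0"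
      using sa ort[of "A (A (y - a))"] by (simp add: self_adjoint_def)
    then have "A (y - a) = 0" by simp
    then have "y - a = 0" using c(1) c(2)[of "y - a"] by (simp add: mult_le_0_iff)
    then show ?thesis using a by simp
  qed
  then show ?thesis by blast
qed

lemma scaleC_zero_right [simp]: "c *\<^sub>C (0::'a::complex_inner) = 0"
  using scaleC_add_right[of c 0 "0::'a"] by simp

lemma scaleC_minus_right: "c *\<^sub>C (- x) = - (c *\<^sub>C (x::'a::complex_inner))"
  using scaleC_add_right[of c x "- x"] by (simp add: eq_neg_iff_add_eq_0 add.commute)

lemma scaleC_diff_right: "c *\<^sub>C (x - y) = c *\<^sub>C x - c *\<^sub>C (y::'a::complex_inner)"
  using scaleC_add_right[of c x "- y"] by (simp add: scaleC_minus_right)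

lemma scaleC_scaleR_commute: "c *\<^sub>C (r *\<^sub>R x) = r *\<^sub>R (c *\<^sub>C (x::'a::complex_inner))"
  by (simp add: scaleC_of_real[symmetric] scaleC_scaleC mult.commute)

text \<open>
  Lower bounds are easier to handle than inverses, and a product inherits them from its factors. A
  self-adjoint operator that is bounded below has a bounded inverse, which
  is complex linear along with \<open>A\<close>.
\<close>

lemma real_spectrum_iff:
  fixes A :: "'a::chilbert_space \<Rightarrow>\<^sub>L 'a"
  assumes "complex_linear A" "self_adjoint A"
  shows "complex_of_real t \<in> spectrum A \<longleftrightarrow> \<not> bounded_below (A - t *\<^sub>R id_blinfun)"
proof -
  define B where "B = A - t *\<^sub>R id_blinfun"
  have B: "B x = A x - complex_of_real t *\<^sub>C x" for x
    by (simp add: B_def blinfun.diff_left blinfun.scaleR_left scaleC_of_real)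
  have B_lin: "B (c *\<^sub>C x) = c *\<^sub>C B x" for c x
    using assms(1)
    by (simp add: B complex_linear_def scaleC_diff_right scaleC_scaleC mult.commute)
  have "bounded_below B \<longleftrightarrow>
      (\<exists>S :: 'a \<Rightarrow>\<^sub>L 'a. complex_linear S \<and> (\<forall>x. B (S x) = x) \<and> (\<forall>x. S (B x) = x))"
  proof
    assume "\<exists>S :: 'a \<Rightarrow>\<^sub>L 'a. complex_linear S \<and> (\<forall>x. B (S x) = x) \<and> (\<forall>x. S (B x) = x)"
    then obtain S :: "'a \<Rightarrow>\<^sub>L 'a" where S: "\<And>x. S (B x) = x" by blast
    have "inverse (norm S + 1) * norm x \<le> norm (B x)" for x
    proof -
      have "norm x \<le> norm S * norm (B x)" using norm_blinfun[of S "B x"] S by simp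
      also have "\<dots> \<le> (norm S + 1) * norm (B x)" by (simp add: mult_right_mono)
      finally show ?thesis
        using norm_ge_zero[of S] by (simp add: pos_divide_le_eq add_nonneg_pos divide_inverse[symmetric] mult.commute)
    qed
    then show "bounded_below B"
      unfolding bounded_below_def by (intro exI[of _ "inverse (norm S + 1)"]) (simp add: add_nonneg_pos)
  next
    assume bb: "bounded_below B"
    then obtain c where c: "c > 0" "\<And>x. c * norm x \<le> norm (B x)"
      unfolding bounded_below_def by blast
    have "self_adjoint B"
      using assms(2) by (simp add: self_adjoint_def B_def blinfun.diff_left blinfun.scaleR_left
          inner_diff_left inner_diff_right)
    then have surj: "surj (blinfun_apply B)"
      using bb by (rule self_adjoint_bounded_below_imp_surj)
    define G where "G = range (\<lambda>x. (B x, x))"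
    have "linear (\<lambda>x. (B x, x))"
      by (rule linearI) (simp_all add: blinfun.add_right blinfun.scaleR_right)
    then have "subspace G" unfolding G_def by (intro linear_subspace_image subspace_UNIV)
    moreover have "\<exists>y. (x, y) \<in> G" for x
      using surjD[OF surj, of x] unfolding G_def by blast
    moreover have "norm y \<le> inverse c * norm x" if "(x, y) \<in> G" for x y
      using that c unfolding G_def by (auto simp: field_simps)
    ultimately obtain S :: "'a \<Rightarrow>\<^sub>L 'a" where S: "\<And>x y. (x, y) \<in> G \<longleftrightarrow> S x = y"
      using blinfun_of_graph[of G "inverse c"] by blast
    have SB: "S (B x) = x" for x
      using S[of "B x" x] by (simp add: G_def)
    have BS: "B (S x) = x" for x
      using surjD[OF surj, of x] SB by auto
    have "S (c *\<^sub>C x) = c *\<^sub>C S x" for c x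
      using SB[of "c *\<^sub>C S x"] by (simp add: B_lin BS)
    with SB BS show "\<exists>S :: 'a \<Rightarrow>\<^sub>L 'a. complex_linear S \<and> (\<forall>x. B (S x) = x) \<and> (\<forall>x. S (B x) = x)"
      unfolding complex_linear_def by blast
  qed
  moreover have "complex_of_real t \<in> spectrum A \<longleftrightarrow>
      \<not> (\<exists>S :: 'a \<Rightarrow>\<^sub>L 'a. complex_linear S \<and> (\<forall>x. B (S x) = x) \<and> (\<forall>x. S (B x) = x))"
    by (simp only: spectrum_def B mem_Collect_eq)
  ultimately show ?thesis by (simp only: B_def[symmetric])
qed

lemma cinner_eqI: 
  fixes x y x' y' :: "'a::complex_inner"
  assumes "\<And>c. inner (c *\<^sub>C x) y = inner (c *\<^sub>C x') y'"
  shows "cinner x y = cinner x' y'"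
proof (rule complex_eqI)
  show "Re (cinner x y) = Re (cinner x' y')"
    using assms[of 1] by (simp add: inner_eq_Re_cinner cinner_scaleC_left)
  show "Im (cinner x y) = Im (cinner x' y')"
    using assms[of \<i>] by (simp add: inner_eq_Re_cinner cinner_scaleC_left)
qed

lemma cinner_scaleC_right: "cinner x (c *\<^sub>C y) = cnj c * cinner x (y::'a::complex_inner)"
  by (metis cinner_commute cinner_scaleC_left complex_cnj_mult)

text \<open>
  Over the reals the adjoint comes from the Riesz representation; complex linearity of \<open>T\<close> turns its
  defining identity for the real inner product into the one for the complex inner product.
\<close>

lemma cadjoint:
  fixes T :: "'a::chilbert_space \<Rightarrow>\<^sub>L 'a"
  assumes "complex_linear T"
  shows "cinner (T x) y = cinner x (cadjoint T y)"
proof -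
  define G where "G = {(y, z). \<forall>x. inner (T x) y = inner x z}"
  have "subspace G"
    by (rule subspaceI) (auto simp: G_def zero_prod_def inner_add_right)
  moreover have "\<exists>z. (y, z) \<in> G" for y
  proof -
    have "bounded_linear (\<lambda>x. inner (T x) y)"
      by (intro bounded_linear_inner_left_comp blinfun.bounded_linear_right)
    then show ?thesis
      using riesz_representation[of "\<lambda>x. inner (T x) y"] by (auto simp: G_def)
  qed
  moreover have "norm z \<le> norm T * norm y" if "(y, z) \<in> G" for y z
  proof -
    have "norm z * norm z = inner (T z) y"
      using that by (simp add: G_def power2_norm_eq_inner[symmetric] power2_eq_square)
    also have "\<dots> \<le> norm (T z) * norm y" by (rule norm_cauchy_schwarz)
    also have "\<dots> \<le> norm T * norm z * norm y" by (intro mult_right_mono norm_blinfun) simp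
    finally have "norm z * norm z \<le> norm z * (norm T * norm y)" by (simp add: algebra_simps)
    then show ?thesis by (cases "z = 0") simp_all
  qed
  ultimately obtain S :: "'a \<Rightarrow>\<^sub>L 'a" where S: "\<And>y z. (y, z) \<in> G \<longleftrightarrow> S y = z"
    using blinfun_of_graph[of G "norm T"] by blast
  have "\<forall>x y. cinner (T x) y = cinner x (S y)"
  proof (intro allI cinner_eqI)
    fix x y c
    have "inner (T (c *\<^sub>C x)) y = inner (c *\<^sub>C x) (S y)"
      using S[of y "S y"] by (simp add: G_def)
    then show "inner (c *\<^sub>C T x) y = inner (c *\<^sub>C x) (S y)"
      using assms by (simp add: complex_linear_def)
  qed
  moreover have "S' = S" if S': "\<forall>x y. cinner (T x) y = cinner x (S' y)" for S' :: "'a \<Rightarrow>\<^sub>L 'a"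
  proof (rule blinfun_eqI)
    fix y
    have "(y, S' y) \<in> G" using S' by (simp add: G_def inner_eq_Re_cinner)
    then show "S' y = S y" using S by simp
  qed
  ultimately have "\<forall>x y. cinner (T x) y = cinner x (cadjoint T y)"
    unfolding cadjoint_def by (rule theI)
  then show ?thesis by blast
qed

lemma inner_cadjoint:
  assumes "complex_linear T"
  shows "inner (T x) y = inner x (cadjoint T y)"
  using cadjoint[OF assms] by (simp add: inner_eq_Re_cinner)

lemma complex_linear_cadjoint:
  fixes T :: "'a::chilbert_space \<Rightarrow>\<^sub>L 'a"
  assumes "complex_linear T"
  shows "complex_linear (cadjoint T)"
  unfolding complex_linear_def
proof (intro allI)
  fix c x
  define d where "d = cadjoint T (c *\<^sub>C x) - c *\<^sub>C cadjoint T x"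
  have "cinner d (cadjoint T (c *\<^sub>C x)) = cinner d (c *\<^sub>C cadjoint T x)"
    by (simp add: cinner_scaleC_right cadjoint[OF assms, symmetric])
  then have "inner d (cadjoint T (c *\<^sub>C x)) = inner d (c *\<^sub>C cadjoint T x)"
    by (simp add: inner_eq_Re_cinner)
  then have "inner d (cadjoint T (c *\<^sub>C x) - c *\<^sub>C cadjoint T x) = 0"
    by (simp only: inner_diff_right)
  then have "inner d d = 0" by (simp add: d_def)
  then show "cadjoint T (c *\<^sub>C x) = c *\<^sub>C cadjoint T x" by (simp add: d_def)
qed

definition positive_op :: "('a::complex_inner \<Rightarrow>\<^sub>L 'a) \<Rightarrow> bool"
  where "positive_op A \<longleftrightarrow> complex_linear A \<and> self_adjoint A \<and> (\<forall>x. 0 \<le> inner (A x) x)"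

lemma positive_op_cadjoint_compose:
  assumes "complex_linear T"
  shows "positive_op (cadjoint T o\<^sub>L T)"
proof -
  have l: "inner (cadjoint T (T x)) y = inner (T x) (T y)" for x y
    using inner_cadjoint[OF assms, of y "T x"] by (simp add: inner_commute)
  have r: "inner x (cadjoint T (T y)) = inner (T x) (T y)" for x y
    using inner_cadjoint[OF assms, of x "T y"] by simp
  show ?thesis
    using assms complex_linear_cadjoint[OF assms]
    by (simp add: positive_op_def self_adjoint_def complex_linear_def l r)
qed

section \<open>Polynomials in an operator\<close>

lemma op_poly_sum:
  assumes "degree p \<le> n"
  shows "op_poly p T = (\<Sum>i\<le>n. coeff p i *\<^sub>R op_pow T i)"
  unfolding op_poly_def
  by (rule sum.mono_neutral_left) (use assms in \<open>auto simp: coeff_eq_0\<close>)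

lemma op_poly_0 [simp]: "op_poly 0 T = 0"
  by (simp add: op_poly_def)

lemma op_poly_pCons: "op_poly (pCons a p) T = a *\<^sub>R id_blinfun + (T o\<^sub>L op_poly p T)"
proof -
  have "op_poly (pCons a p) T = (\<Sum>i\<le>Suc (degree p). coeff (pCons a p) i *\<^sub>R op_pow T i)"
    by (rule op_poly_sum) (rule degree_pCons_le)
  also have "\<dots> = a *\<^sub>R id_blinfun + (\<Sum>i\<le>degree p. coeff p i *\<^sub>R (T o\<^sub>L op_pow T i))"
    by (subst sum.atMost_Suc_shift) (simp add: op_pow_Suc)
  also have "(\<Sum>i\<le>degree p. coeff p i *\<^sub>R (T o\<^sub>L op_pow T i)) = T o\<^sub>L op_poly p T"
    by (rule blinfun_eqI)
      (simp add: op_poly_def blinfun.sum_left blinfun.sum_right blinfun.scaleR_left blinfun.scaleR_right)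
  finally show ?thesis .
qed

lemma op_poly_linear: "op_poly [:- r, 1:] T = T - r *\<^sub>R id_blinfun"
  by (rule blinfun_eqI) (simp add: op_poly_pCons blinfun.add_left blinfun.diff_left
      blinfun.scaleR_left blinfun.add_right)

lemma op_poly_add: "op_poly (p + q) T = op_poly p T + op_poly q T"
proof -
  have "degree (p + q) \<le> max (degree p) (degree q)" by (rule degree_add_le_max)
  then show ?thesis
    by (simp add: op_poly_sum[of _ "max (degree p) (degree q)"] scaleR_add_left sum.distrib)
qed

lemma op_poly_diff: "op_poly (p - q) T = op_poly p T - op_poly q T"
  using op_poly_add[of "p - q" q T] by (simp add: algebra_simps)

lemma op_poly_smult: "op_poly (smult c p) T = c *\<^sub>R op_poly p T"
  by (simp add: op_poly_sum[of _ "degree p"] scaleR_sum_right)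

lemma op_poly_mult: "op_poly (p * q) T = op_poly p T o\<^sub>L op_poly q T"
proof (induction p)
  case (pCons a p)
  show ?case
    by (rule blinfun_eqI)
      (simp add: mult_pCons_left op_poly_add op_poly_smult op_poly_pCons pCons.IH blinfun.add_left
        blinfun.scaleR_left)
qed simp

lemma op_poly_commute: "T (op_poly p T x) = op_poly p T (T x)"
proof -
  have X: "op_poly [:0, 1:] T = T"
    using op_poly_linear[of 0 T] by simp
  have "T o\<^sub>L op_poly p T = op_poly ([:0, 1:] * p) T"
    by (simp only: op_poly_mult X)
  also have "[:0, 1:] * p = p * [:0, 1:]" by (rule mult.commute)
  also have "op_poly \<dots> T = op_poly p T o\<^sub>L T"
    by (simp only: op_poly_mult X)
  finally have "(T o\<^sub>L op_poly p T) x = (op_poly p T o\<^sub>L T) x" by simp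
  then show ?thesis by simp
qed

lemma self_adjoint_op_poly:
  assumes "self_adjoint A"
  shows "self_adjoint (op_poly p A)"
proof (induction p)
  case 0
  show ?case by (simp add: self_adjoint_def)
next
  case (pCons a p)
  have "inner (A (op_poly p A x)) y = inner x (A (op_poly p A y))" for x y
    using assms pCons.IH unfolding op_poly_commute[of A p y] by (simp add: self_adjoint_def)
  then show ?case
    by (simp add: self_adjoint_def op_poly_pCons blinfun.add_left blinfun.scaleR_left
        inner_add_left inner_add_right)
qed

lemma complex_linear_op_poly:
  assumes "complex_linear A"
  shows "complex_linear (op_poly p A)"
proof (induction p)
  case (pCons a p)
  then show ?case
    using assms
    by (simp add: complex_linear_def op_poly_pCons blinfun.add_left blinfun.scaleR_left
        scaleC_add_right scaleC_scaleR_commute)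
qed (simp add: complex_linear_def)

text \<open>
  A complex zero \<open>a + i b\<close> of a real polynomial with \<open>b \<noteq> 0\<close> brings the factor \<open>(t - a)\<^sup>2 + b\<^sup>2\<close>: the
  remainder on division by it is a real polynomial of degree at most one that vanishes at a point
  off the real line, so it is zero. Staying with real factors makes it possible to factor \<open>q(A)\<close>
  without complex scalars.
\<close>

lemma real_poly_has_linear_or_quadratic_factor:
  fixes q :: "real poly"
  assumes "degree q > 0"
  obtains (linear) r where "[:- r, 1:] dvd q"
    | (quadratic) a b where "b \<noteq> 0" "[:a\<^sup>2 + b\<^sup>2, - (2 * a), 1:] dvd q"
proof -
  define ev where "ev p z = poly (map_poly complex_of_real p) z" for p z
  have ev_0: "ev 0 z = 0" for z by (simp add: ev_def)
  have ev_pCons: "ev (pCons a p) z = of_real a + z * ev p z" for a p z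
    by (cases "a = 0 \<and> p = 0") (auto simp: ev_def map_poly_pCons)
  have ev_add: "ev (p + p') z = ev p z + ev p' z" for p p' z
    by (induction p p' rule: poly_induct2) (simp_all add: ev_0 ev_pCons algebra_simps)
  have ev_smult: "ev (smult c p) z = of_real c * ev p z" for c p z
    by (induction p) (simp_all add: ev_0 ev_pCons algebra_simps)
  have ev_mult: "ev (p * p') z = ev p z * ev p' z" for p p' z
    by (induction p) (simp_all add: ev_0 ev_pCons ev_add ev_smult algebra_simps)
  have ev_real: "ev p (of_real r) = of_real (poly p r)" for p r
    by (induction p) (simp_all add: ev_0 ev_pCons)
  have "degree (map_poly complex_of_real q) = degree q"
    by (rule degree_map_poly) simp
  with assms have "\<not> constant (poly (map_poly complex_of_real q))"
    by (simp add: constant_degree)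
  then obtain z where z: "ev q z = 0"
    unfolding ev_def using fundamental_theorem_of_algebra by blast
  show thesis
  proof (cases "Im z = 0")
    case True
    then have "z = of_real (Re z)" by (simp add: complex_eq_iff)
    with z have "poly q (Re z) = 0" using ev_real[of q "Re z"] by simp
    then show thesis using linear by (simp add: poly_eq_0_iff_dvd)
  next
    case False
    define m where "m = [:(Re z)\<^sup>2 + (Im z)\<^sup>2, - (2 * Re z), 1:]"
    have ev_m: "ev m z = 0"
      by (simp add: m_def ev_pCons ev_0 complex_eq_iff power2_eq_square algebra_simps)
    have "q mod m = 0"
    proof (rule ccontr)
      assume nz: "q mod m \<noteq> 0"
      have "degree (q mod m) < degree m"
        using nz by (intro degree_mod_less') (simp_all add: m_def)
      then have deg: "degree (q mod m) \<le> 1" by (simp add: m_def)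
      obtain c p where cp: "q mod m = pCons c p" by (rule pCons_cases)
      with deg have "degree p = 0" by (cases "p = 0") auto
      then obtain d where d: "p = [:d:]" by (rule degree_eq_zeroE)
      have "ev q z = ev (q div m * m + q mod m) z" by simp
      then have "ev (q mod m) z = 0" using z by (simp only: ev_add ev_mult ev_m) simp
      then have "of_real c + z * of_real d = 0" by (simp add: cp d ev_pCons ev_0)
      then have "c + Re z * d = 0" "Im z * d = 0" by (simp_all add: complex_eq_iff)
      with False nz show False by (simp add: cp d)
    qed
    then have "m dvd q" by (simp add: dvd_eq_mod_eq_0)
    with False show thesis using quadratic unfolding m_def by blast
  qed
qed

section \<open>The norm of a polynomial in a self-adjoint operator\<close>

text \<open>
  A factor \<open>(t - a)\<^sup>2 + b\<^sup>2\<close> of \<open>q\<close> without real zeros contributes an operator that is bounded below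
  by \<open>b\<^sup>2\<close>, because \<open>A - a\<close> is self-adjoint; so only the real zeros of \<open>q\<close> matter.
\<close>

lemma op_poly_bounded_below:
  fixes A :: "'a::real_inner \<Rightarrow>\<^sub>L 'a"
  assumes sa: "self_adjoint A" and "q \<noteq> 0"
    and "\<And>r. poly q r = 0 \<Longrightarrow> bounded_below (A - r *\<^sub>R id_blinfun)"
  shows "bounded_below (op_poly q A)"
  using assms(2,3)
proof (induction "degree q" arbitrary: q rule: less_induct)
  case less
  have reduce: "bounded_below (op_poly q A)"
    if q: "q = m * k" and "degree m > 0" and m: "bounded_below (op_poly m A)" for m k
  proof -
    have "m \<noteq> 0" "k \<noteq> 0" using q less.prems(1) by auto
    then have "degree k < degree q" using \<open>degree m > 0\<close> by (simp add: q degree_mult_eq)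
    then have "bounded_below (op_poly k A)"
      using less.hyps[of k] less.prems(2) \<open>k \<noteq> 0\<close> by (simp add: q)
    with m show ?thesis by (simp add: q op_poly_mult bounded_below_compose)
  qed
  show ?case
  proof (cases "degree q = 0")
    case True
    then obtain c where c: "q = [:c:]" by (rule degree_eq_zeroE)
    then have "c \<noteq> 0" using less.prems by simp
    then show ?thesis
      unfolding bounded_below_def
      by (intro exI[of _ "\<bar>c\<bar>"])
        (simp add: c op_poly_pCons blinfun.add_left blinfun.scaleR_left)
  next
    case False
    then have "degree q > 0" by simp
    then show ?thesis
    proof (cases rule: real_poly_has_linear_or_quadratic_factor)
      case (linear r)
      then obtain k where k: "q = [:- r, 1:] * k" by (elim dvdE)
      then have "poly q r = 0" by simp
      then have "bounded_below (op_poly [:- r, 1:] A)"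
        using less.prems(2) by (simp add: op_poly_linear)
      with k show ?thesis by (intro reduce) auto
    next
      case (quadratic a b)
      define m where "m = [:a\<^sup>2 + b\<^sup>2, - (2 * a), 1:]"
      obtain k where k: "q = m * k" using quadratic(2) unfolding m_def by (elim dvdE)
      have "b\<^sup>2 * norm x \<le> norm (op_poly m A x)" for x
      proof -
        have mx: "op_poly m A x = (a\<^sup>2 + b\<^sup>2) *\<^sub>R x - (2 * a) *\<^sub>R A x + A (A x)"
          by (simp add: m_def op_poly_pCons blinfun.add_left blinfun.scaleR_left blinfun.add_right
              blinfun.scaleR_right blinfun.diff_left blinfun.diff_right)
        have "inner (A (A x)) x = inner (A x) (A x)"
          using sa by (simp add: self_adjoint_def)
        then have "inner (op_poly m A x) x
            = inner (A x - a *\<^sub>R x) (A x - a *\<^sub>R x) + b\<^sup>2 * inner x x"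
          by (simp add: mx inner_add_left inner_diff_left inner_diff_right inner_commute
              power2_eq_square algebra_simps)
        then have "b\<^sup>2 * inner x x \<le> inner (op_poly m A x) x" by simp
        also have "\<dots> \<le> norm (op_poly m A x) * norm x" by (rule norm_cauchy_schwarz)
        finally have "(b\<^sup>2 * norm x) * norm x \<le> norm (op_poly m A x) * norm x"
          by (simp add: power2_norm_eq_inner[symmetric] power2_eq_square mult.assoc)
        then show ?thesis by (cases "x = 0") simp_all
      qed
      then have "bounded_below (op_poly m A)"
        unfolding bounded_below_def using quadratic(1) by (intro exI[of _ "b\<^sup>2"]) simp
      with k show ?thesis by (intro reduce) (auto simp: m_def)
    qed
  qed
qed

text \<open>
  On unit vectors with \<open>norm (B x)\<close> close to \<open>N = norm B\<close>, the difference \<open>B (B x) - N\<^sup>2 x\<close> is small.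
  Quantitatively, a lower bound for this difference keeps \<open>norm (B x)\<close> away from \<open>N\<close> on all unit
  vectors.
\<close>

lemma self_adjoint_square_not_bounded_below:
  fixes B :: "'a::real_inner \<Rightarrow>\<^sub>L 'a"
  assumes sa: "self_adjoint B" and nontrivial: "\<exists>x::'a. x \<noteq> 0"
  shows "\<not> bounded_below ((B o\<^sub>L B) - (norm B)\<^sup>2 *\<^sub>R id_blinfun)"
proof
  define N where "N = norm B"
  assume "bounded_below ((B o\<^sub>L B) - (norm B)\<^sup>2 *\<^sub>R id_blinfun)"
  then obtain c where c: "c > 0" "\<And>x. c * norm x \<le> norm (B (B x) - N\<^sup>2 *\<^sub>R x)"
    unfolding bounded_below_def by (auto simp: N_def blinfun.diff_left blinfun.scaleR_left)
  have key: "c\<^sup>2 * (norm x)\<^sup>2 \<le> N\<^sup>2 * (N\<^sup>2 * (norm x)\<^sup>2 - (norm (B x))\<^sup>2)" for x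
  proof -
    have e: "inner (B (B x)) x = inner (B x) (B x)"
      using sa by (simp add: self_adjoint_def)
    have "c\<^sup>2 * (norm x)\<^sup>2 \<le> (norm (B (B x) - N\<^sup>2 *\<^sub>R x))\<^sup>2"
      using power_mono[OF c(2), of x 2] c(1) by (simp add: power_mult_distrib)
    also have "\<dots> = (norm (B (B x)))\<^sup>2 - 2 * N\<^sup>2 * (norm (B x))\<^sup>2 + N\<^sup>2 * N\<^sup>2 * (norm x)\<^sup>2"
      using e by (simp add: power2_norm_eq_inner inner_diff_left inner_diff_right inner_commute
          algebra_simps)
    also have "(norm (B (B x)))\<^sup>2 \<le> N\<^sup>2 * (norm (B x))\<^sup>2"
      using power_mono[OF norm_blinfun, of B "B x" 2] by (simp add: N_def power_mult_distrib)
    finally show ?thesis by (simp add: algebra_simps)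
  qed
  obtain x0 :: 'a where "x0 \<noteq> 0" using nontrivial by blast
  have "N \<noteq> 0"
  proof
    assume "N = 0"
    with key[of x0] c(1) \<open>x0 \<noteq> 0\<close> show False by (simp add: mult_le_0_iff)
  qed
  then have "N > 0" by (simp add: N_def)
  define d where "d = N\<^sup>2 - c\<^sup>2 / N\<^sup>2"
  have le: "(norm (B x))\<^sup>2 \<le> d * (norm x)\<^sup>2" for x
    using key[of x] \<open>N > 0\<close> by (simp add: d_def field_simps)
  have "d \<ge> 0"
    using le[of x0] zero_le_power2[of "norm (B x0)"] \<open>x0 \<noteq> 0\<close>
    by (smt (verit) mult_neg_pos zero_less_norm_iff zero_less_power)
  have "N \<le> sqrt d"
    unfolding N_def
  proof (rule norm_blinfun_bound)
    show "norm (B x) \<le> sqrt d * norm x" for x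
      using real_sqrt_le_mono[OF le[of x]] by (simp add: real_sqrt_mult)
  qed (use \<open>d \<ge> 0\<close> in simp)
  then have "N\<^sup>2 \<le> (sqrt d)\<^sup>2" using \<open>N > 0\<close> by (intro power_mono) auto
  then show False using \<open>d \<ge> 0\<close> \<open>N > 0\<close> c(1) by (simp add: d_def field_simps)
qed

text \<open>
  If \<open>p\<^sup>2 - N\<^sup>2\<close> is the zero polynomial, it has no factors and the argument yields no point of the
  spectrum; hence the last assumption.
\<close>

lemma op_poly_norm_attained:
  fixes A :: "'a::chilbert_space \<Rightarrow>\<^sub>L 'a"
  assumes A: "complex_linear A" "self_adjoint A" and "\<exists>x::'a. x \<noteq> 0"
    and nonconst: "p * p \<noteq> [:(norm (op_poly p A))\<^sup>2:]"
  obtains t where "complex_of_real t \<in> spectrum A" "\<bar>poly p t\<bar> = norm (op_poly p A)"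
proof -
  define N where "N = norm (op_poly p A)"
  define q where "q = p * p - [:N\<^sup>2:]"
  have "op_poly q A = (op_poly p A o\<^sub>L op_poly p A) - N\<^sup>2 *\<^sub>R id_blinfun"
    by (simp add: q_def op_poly_diff op_poly_mult op_poly_pCons)
  then have "\<not> bounded_below (op_poly q A)"
    using self_adjoint_square_not_bounded_below[OF self_adjoint_op_poly[OF A(2)] assms(3)]
    by (simp add: N_def)
  moreover have "q \<noteq> 0" using nonconst by (simp add: q_def N_def)
  ultimately obtain t where t: "poly q t = 0" "\<not> bounded_below (A - t *\<^sub>R id_blinfun)"
    using op_poly_bounded_below[OF A(2)] by blast
  have "(poly p t)\<^sup>2 = N\<^sup>2" using t(1) by (simp add: q_def power2_eq_square)
  then have "\<bar>poly p t\<bar> = \<bar>N\<bar>" by (simp only: power2_eq_iff_nonneg abs_ge_zero flip: power2_abs[of "poly p t"] power2_abs[of N])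
  then show thesis
    using that t(2) real_spectrum_iff[OF A, of t] by (simp add: N_def)
qed

text \<open>
  If \<open>p\<^sup>2\<close> is the constant \<open>(norm (op_poly p A))\<^sup>2\<close>, the modulus of \<open>p\<close> is the norm everywhere, and a
  real point of the spectrum is still needed; the norm attained by the polynomial \<open>t\<close> supplies one.
  On the trivial space the spectrum is empty, but every operator is zero.
\<close>

proposition op_poly_norm_le:
  fixes A :: "'a::chilbert_space \<Rightarrow>\<^sub>L 'a"
  assumes A: "complex_linear A" "self_adjoint A"
    and e: "\<And>t. complex_of_real t \<in> spectrum A \<Longrightarrow> \<bar>poly p t\<bar> \<le> e" and "e \<ge> 0"
  shows "norm (op_poly p A) \<le> e"
proof (cases "\<exists>x::'a. x \<noteq> 0")
  case False
  then have "op_poly p A = 0" by (intro blinfun_eqI) (metis blinfun.zero_left)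
  then show ?thesis using \<open>e \<ge> 0\<close> by simp
next
  case nontrivial: True
  show ?thesis
  proof (cases "p * p = [:(norm (op_poly p A))\<^sup>2:]")
    case False
    then show ?thesis using op_poly_norm_attained[OF A nontrivial] e by metis
  next
    case True
    have "[:0, 1:] * [:0, 1:] \<noteq> [:(norm (op_poly [:0, 1:] A))\<^sup>2:]" by simp
    then obtain t where t: "complex_of_real t \<in> spectrum A"
      using op_poly_norm_attained[OF A nontrivial] by metis
    have "(poly p t)\<^sup>2 = (norm (op_poly p A))\<^sup>2"
      using arg_cong[OF True, of "\<lambda>r. poly r t"] by (simp add: power2_eq_square)
    then have "\<bar>poly p t\<bar> = norm (op_poly p A)"
      by (metis abs_norm_cancel power2_eq_iff_nonneg abs_ge_zero norm_ge_zero power2_abs)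
    then show ?thesis using e[OF t] by simp
  qed
qed

section \<open>The continuous functional calculus\<close>

instance chilbert_space \<subseteq> banach ..

text \<open>
  The bound of \<open>op_poly_norm_le\<close> turns uniform convergence on the spectrum into convergence
  in operator norm, and makes the limit independent of the approximating polynomials.
\<close>

lemma cont_fun_calc_tendsto:
  fixes A :: "'a::chilbert_space \<Rightarrow>\<^sub>L 'a"
  assumes A: "complex_linear A" "self_adjoint A"
    and p: "uniform_limit {t. complex_of_real t \<in> spectrum A} (\<lambda>n t. poly (p n) t) f sequentially"
  shows "(\<lambda>n. op_poly (p n) A) \<longlonglongrightarrow> cont_fun_calc f A"
proof -
  let ?lim = "\<lambda>p. uniform_limit {t. complex_of_real t \<in> spectrum A} (\<lambda>n t. poly (p n) t) f sequentially"
  have close: "\<exists>N. \<forall>m\<ge>N. \<forall>n\<ge>N. norm (op_poly (p m) A - op_poly (q n) A) < e"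
    if p: "?lim p" and q: "?lim q" and "e > 0" for p q :: "nat \<Rightarrow> real poly" and e
  proof -
    have "e / 4 > 0" using \<open>e > 0\<close> by simp
    then obtain M N where
      M: "\<And>n t. \<lbrakk>n \<ge> M; complex_of_real t \<in> spectrum A\<rbrakk> \<Longrightarrow> dist (poly (p n) t) (f t) < e / 4" and
      N: "\<And>n t. \<lbrakk>n \<ge> N; complex_of_real t \<in> spectrum A\<rbrakk> \<Longrightarrow> dist (poly (q n) t) (f t) < e / 4"
      using p q unfolding uniform_limit_sequentially_iff by (metis mem_Collect_eq)
    have "norm (op_poly (p m) A - op_poly (q n) A) < e" if "m \<ge> max M N" "n \<ge> max M N" for m n
    proof -
      have "\<bar>poly (p m - q n) t\<bar> \<le> e / 2" if "complex_of_real t \<in> spectrum A" for t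
      proof -
        have "\<bar>poly (p m) t - f t\<bar> < e / 4" "\<bar>poly (q n) t - f t\<bar> < e / 4"
          using M[of m t] N[of n t] that \<open>m \<ge> max M N\<close> \<open>n \<ge> max M N\<close>
          by (simp_all add: dist_real_def)
        then show ?thesis unfolding poly_diff by linarith
      qed
      then have "norm (op_poly (p m - q n) A) \<le> e / 2"
        using \<open>e > 0\<close> by (intro op_poly_norm_le[OF A]) auto
      then show ?thesis using \<open>e > 0\<close> by (simp add: op_poly_diff)
    qed
    then show ?thesis by blast
  qed
  have "Cauchy (\<lambda>n. op_poly (p n) A)"
    by (rule CauchyI) (rule close[OF p p])
  moreover have "complete (UNIV :: ('a \<Rightarrow>\<^sub>L 'a) set)"
    by (rule complete_UNIV)
  ultimately obtain B where B: "(\<lambda>n. op_poly (p n) A) \<longlonglongrightarrow> B"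
    unfolding complete_def by blast
  have all: "(\<lambda>n. op_poly (q n) A) \<longlonglongrightarrow> B" if q: "?lim q" for q
  proof -
    have "(\<lambda>n. op_poly (q n) A - op_poly (p n) A) \<longlonglongrightarrow> 0"
      unfolding LIMSEQ_iff using close[OF q p] by simp blast
    from tendsto_add[OF this B] show ?thesis by simp
  qed
  have "\<forall>p. ?lim p \<longrightarrow> (\<lambda>n. op_poly (p n) A) \<longlonglongrightarrow> cont_fun_calc f A"
    unfolding cont_fun_calc_def
  proof (rule theI)
    show "\<forall>p. ?lim p \<longrightarrow> (\<lambda>n. op_poly (p n) A) \<longlonglongrightarrow> B" using all by blast
    show "B' = B" if "\<forall>p. ?lim p \<longrightarrow> (\<lambda>n. op_poly (p n) A) \<longlonglongrightarrow> B'" for B'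
      using that p B LIMSEQ_unique by blast
  qed
  with p show ?thesis by blast
qed

section \<open>Powers of positive operators\<close>

text \<open>
  Below zero the lower bound comes from positivity, beyond the norm from the triangle inequality.
  This interval is where powers are approximated by polynomials.
\<close>

lemma positive_op_real_spectrum:
  assumes "positive_op A" "complex_of_real t \<in> spectrum A"
  shows "t \<in> {0..norm A}"
proof (rule ccontr)
  have A: "complex_linear A" "self_adjoint A" and pos: "\<And>x. 0 \<le> inner (A x) x"
    using assms(1) by (auto simp: positive_op_def)
  assume "t \<notin> {0..norm A}"
  then consider "t < 0" | "t > norm A" by fastforce
  then have "bounded_below (A - t *\<^sub>R id_blinfun)"
  proof cases
    case 1
    have "- t * norm x \<le> norm (A x - t *\<^sub>R x)" for x
    proof -
      have "- t * norm x * norm x \<le> inner (A x) x - t * inner x x"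
        using pos[of x] by (simp add: power2_norm_eq_inner[symmetric] power2_eq_square)
      also have "\<dots> = inner (A x - t *\<^sub>R x) x" by (simp add: inner_diff_left)
      also have "\<dots> \<le> norm (A x - t *\<^sub>R x) * norm x" by (rule norm_cauchy_schwarz)
      finally show ?thesis
        using mult_right_le_imp_le[of "- t * norm x" "norm x"] by (cases "x = 0") simp_all
    qed
    with 1 show ?thesis
      unfolding bounded_below_def
      by (intro exI[of _ "- t"]) (simp add: blinfun.diff_left blinfun.scaleR_left)
  next
    case 2
    have "(t - norm A) * norm x \<le> norm (A x - t *\<^sub>R x)" for x
    proof -
      have "t > 0" using 2 norm_ge_zero[of A] by linarith
      then have "t * norm x \<le> norm (A x) + norm (A x - t *\<^sub>R x)"
        using norm_triangle_ineq4[of "A x" "A x - t *\<^sub>R x"] by simp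
      then show ?thesis using norm_blinfun[of A x] by (simp add: algebra_simps)
    qed
    with 2 show ?thesis
      unfolding bounded_below_def
      by (intro exI[of _ "t - norm A"]) (simp add: blinfun.diff_left blinfun.scaleR_left)
  qed
  then show False using assms(2) real_spectrum_iff[OF A] by blast
qed

lemma powr_uniform_limit_of_polys:
  assumes "r > 0"
  obtains p where "uniform_limit {0..N} (\<lambda>n t. poly (p n) t) (\<lambda>t::real. t powr r) sequentially"
proof -
  have cont: "continuous_on {0..N} (\<lambda>t. t powr r)"
    using assms by (intro continuous_on_powr' continuous_intros) auto
  have "\<exists>p. \<forall>t\<in>{0..N}. \<bar>t powr r - poly p t\<bar> < inverse (real (Suc n))" for n
  proof -
    obtain g where g: "real_polynomial_function g"
      "\<And>t. t \<in> {0..N} \<Longrightarrow> \<bar>t powr r - g t\<bar> < inverse (real (Suc n))"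
      using Stone_Weierstrass_real_polynomial_function[OF compact_Icc cont, of "inverse (real (Suc n))"]
      by auto
    obtain a k where "g = (\<lambda>t. \<Sum>i\<le>k. a i * t ^ i)"
      using real_polynomial_function_imp_sum[OF g(1)] by blast
    then have "g t = poly (\<Sum>i\<le>k. monom (a i) i) t" for t
      by (simp add: poly_sum poly_monom)
    with g(2) show ?thesis by metis
  qed
  then obtain p where p: "\<And>n t. t \<in> {0..N} \<Longrightarrow> \<bar>t powr r - poly (p n) t\<bar> < inverse (real (Suc n))"
    by metis
  have "uniform_limit {0..N} (\<lambda>n t. poly (p n) t) (\<lambda>t. t powr r) sequentially"
    unfolding uniform_limit_sequentially_iff
  proof (intro allI impI)
    fix e :: real assume "e > 0"
    then obtain K where K: "inverse (real (Suc K)) < e" using reals_Archimedean by blast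
    have "dist (poly (p n) t) (t powr r) < e" if "n \<ge> K" "t \<in> {0..N}" for n t
    proof -
      have "inverse (real (Suc n)) \<le> inverse (real (Suc K))"
        using \<open>n \<ge> K\<close> by (intro le_imp_inverse_le) auto
      with p[OF that(2), of n] K show ?thesis by (simp only: dist_real_def abs_minus_commute)
    qed
    then show "\<exists>K. \<forall>n\<ge>K. \<forall>t\<in>{0..N}. dist (poly (p n) t) (t powr r) < e" by blast
  qed
  then show thesis using that by blast
qed

lemma op_powr_approx:
  assumes "positive_op A" "r > 0"
  obtains p where
    "uniform_limit {t. complex_of_real t \<in> spectrum A} (\<lambda>n t. poly (p n) t) (\<lambda>t. t powr r) sequentially"
    "(\<lambda>n. op_poly (p n) A) \<longlonglongrightarrow> op_powr A r"
proof -
  obtain p where "uniform_limit {0..norm A} (\<lambda>n t. poly (p n) t) (\<lambda>t. t powr r) sequentially"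
    using powr_uniform_limit_of_polys[OF assms(2)] by metis
  then have p: "uniform_limit {t. complex_of_real t \<in> spectrum A} (\<lambda>n t. poly (p n) t)
      (\<lambda>t. t powr r) sequentially"
    by (rule uniform_limit_on_subset) (use positive_op_real_spectrum[OF assms(1)] in blast)
  moreover have "(\<lambda>n. op_poly (p n) A) \<longlonglongrightarrow> op_powr A r"
    unfolding op_powr_def
    by (rule cont_fun_calc_tendsto[OF _ _ p]) (use assms(1) in \<open>auto simp: positive_op_def\<close>)
  ultimately show thesis by (rule that)
qed

lemma op_powr_add:
  assumes A: "positive_op A" and "r > 0" "s > 0"
  shows "op_powr A (r + s) = op_powr A r o\<^sub>L op_powr A s"
proof -
  let ?\<sigma> = "{t. complex_of_real t \<in> spectrum A}"
  obtain p where p: "uniform_limit ?\<sigma> (\<lambda>n t. poly (p n) t) (\<lambda>t. t powr r) sequentially"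
    "(\<lambda>n. op_poly (p n) A) \<longlonglongrightarrow> op_powr A r"
    using op_powr_approx[OF A \<open>r > 0\<close>] by metis
  obtain q where q: "uniform_limit ?\<sigma> (\<lambda>n t. poly (q n) t) (\<lambda>t. t powr s) sequentially"
    "(\<lambda>n. op_poly (q n) A) \<longlonglongrightarrow> op_powr A s"
    using op_powr_approx[OF A \<open>s > 0\<close>] by metis
  have bdd: "bounded ((\<lambda>t. t powr u) ` ?\<sigma>)" if "u > 0" for u
  proof (rule boundedI)
    fix y assume "y \<in> (\<lambda>t. t powr u) ` ?\<sigma>"
    then obtain t where "y = t powr u" "0 \<le> t" "t \<le> norm A"
      using positive_op_real_spectrum[OF A] by auto
    then show "norm y \<le> norm A powr u" using that by (simp add: powr_mono2)
  qed
  have "uniform_limit ?\<sigma> (\<lambda>n t. poly (p n) t * poly (q n) t) (\<lambda>t. t powr r * t powr s) sequentially"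
    using p(1) q(1) bdd[OF \<open>r > 0\<close>] bdd[OF \<open>s > 0\<close>] by (rule uniform_lim_mult)
  then have "uniform_limit ?\<sigma> (\<lambda>n t. poly (p n * q n) t) (\<lambda>t. t powr (r + s)) sequentially"
    by (simp add: powr_add)
  then have "(\<lambda>n. op_poly (p n * q n) A) \<longlonglongrightarrow> op_powr A (r + s)"
    unfolding op_powr_def using A by (intro cont_fun_calc_tendsto) (auto simp: positive_op_def)
  moreover have "(\<lambda>n. op_poly (p n * q n) A) \<longlonglongrightarrow> (op_powr A r o\<^sub>L op_powr A s)"
    unfolding op_poly_mult by (intro bounded_bilinear.tendsto[OF bounded_bilinear_blinfun_compose] p q)
  ultimately show ?thesis by (rule LIMSEQ_unique)
qed

lemma op_powr_one:
  assumes A: "positive_op A"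
  shows "op_powr A 1 = A"
proof -
  have X: "op_poly [:0, 1:] A = A" using op_poly_linear[of 0 A] by simp
  have "uniform_limit {t. complex_of_real t \<in> spectrum A} (\<lambda>n t. poly [:0, 1:] t) (\<lambda>t. t powr 1)
      sequentially"
    unfolding uniform_limit_sequentially_iff
    using positive_op_real_spectrum[OF A] by auto
  then have "(\<lambda>n. op_poly [:0, 1:] A) \<longlonglongrightarrow> op_powr A 1"
    unfolding op_powr_def using A
    by (intro cont_fun_calc_tendsto[where p = "\<lambda>_. [:0, 1:]"]) (auto simp: positive_op_def)
  then show ?thesis by (simp add: X LIMSEQ_const_iff)
qed

lemma bounded_linear_scaleC: "bounded_linear (\<lambda>x. c *\<^sub>C (x::'a::complex_inner))"
proof (rule bounded_linear_intro[where K = "cmod c"])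
  show "norm (c *\<^sub>C x) \<le> norm x * cmod c" for x :: 'a
  proof -
    have "inner (c *\<^sub>C x) (c *\<^sub>C x) = Re ((c * cnj c) * cinner x x)"
      by (simp only: inner_eq_Re_cinner cinner_scaleC_left cinner_scaleC_right mult_ac)
    also have "(c * cnj c) * cinner x x = (cmod c)\<^sup>2 *\<^sub>R cinner x x"
      by (simp only: complex_norm_square[symmetric] scaleR_conv_of_real of_real_power)
    also have "Re \<dots> = (cmod c)\<^sup>2 * inner x x"
      by (simp add: inner_eq_Re_cinner)
    finally have "(norm (c *\<^sub>C x))\<^sup>2 = (norm x * cmod c)\<^sup>2"
      by (simp add: power2_norm_eq_inner power_mult_distrib)
    then show ?thesis by (simp add: power2_eq_iff_nonneg)
  qed
qed (simp_all add: scaleC_add_right scaleC_scaleR_commute)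

text \<open>
  Linearity and symmetry survive the limit, but the approximating polynomials need not be
  nonnegative on the spectrum. Positivity comes from \<open>A\<^sup>r\<close> being the square of \<open>A\<^sup>r\<^sup>/\<^sup>2\<close>.
\<close>

lemma positive_op_powr:
  assumes A: "positive_op A" and "r > 0"
  shows "positive_op (op_powr A r)"
proof -
  have lin_sa: "complex_linear (op_powr A u) \<and> self_adjoint (op_powr A u)" if "u > 0" for u
  proof -
    obtain p where "(\<lambda>n. op_poly (p n) A) \<longlonglongrightarrow> op_powr A u"
      using op_powr_approx[OF A \<open>u > 0\<close>] by metis
    then have lim: "(\<lambda>n. op_poly (p n) A x) \<longlonglongrightarrow> op_powr A u x" for x
      by (intro blinfun.tendsto tendsto_const)
    have p: "op_poly (p n) A (c *\<^sub>C x) = c *\<^sub>C op_poly (p n) A x"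
      "inner (op_poly (p n) A x) y = inner x (op_poly (p n) A y)" for n c x y
      using A self_adjoint_op_poly[of A "p n"] complex_linear_op_poly[of A "p n"]
      by (auto simp: positive_op_def complex_linear_def self_adjoint_def)
    have "op_powr A u (c *\<^sub>C x) = c *\<^sub>C op_powr A u x" for c x
    proof (rule LIMSEQ_unique)
      show "(\<lambda>n. op_poly (p n) A (c *\<^sub>C x)) \<longlonglongrightarrow> op_powr A u (c *\<^sub>C x)" by (rule lim)
      show "(\<lambda>n. op_poly (p n) A (c *\<^sub>C x)) \<longlonglongrightarrow> c *\<^sub>C op_powr A u x"
        unfolding p by (rule bounded_linear.tendsto[OF bounded_linear_scaleC lim])
    qed
    moreover have "inner (op_powr A u x) y = inner x (op_powr A u y)" for x y
    proof (rule LIMSEQ_unique)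
      show "(\<lambda>n. inner (op_poly (p n) A x) y) \<longlonglongrightarrow> inner (op_powr A u x) y"
        by (intro tendsto_intros lim)
      show "(\<lambda>n. inner (op_poly (p n) A x) y) \<longlonglongrightarrow> inner x (op_powr A u y)"
        unfolding p by (intro tendsto_intros lim)
    qed
    ultimately show ?thesis by (simp add: complex_linear_def self_adjoint_def)
  qed
  have "0 \<le> inner (op_powr A r x) x" for x
  proof -
    have "op_powr A r x = op_powr A (r/2) (op_powr A (r/2) x)"
      using op_powr_add[OF A, of "r/2" "r/2"] \<open>r > 0\<close> by simp
    then have "inner (op_powr A r x) x = inner (op_powr A (r/2) x) (op_powr A (r/2) x)"
      using lin_sa[of "r/2"] \<open>r > 0\<close> by (simp add: self_adjoint_def)
    then show ?thesis by simp
  qed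
  with lin_sa[OF \<open>r > 0\<close>] show ?thesis by (simp add: positive_op_def)
qed

section \<open>The polar decomposition\<close>

lemma positive_op_abs:
  assumes "complex_linear T"
  shows "positive_op (op_abs T)"
  unfolding op_abs_def by (rule positive_op_powr[OF positive_op_cadjoint_compose[OF assms]]) simp

lemma norm_op_abs:
  assumes T: "complex_linear T"
  shows "norm (op_abs T x) = norm (T x)"
proof -
  have pos: "positive_op (cadjoint T o\<^sub>L T)" by (rule positive_op_cadjoint_compose[OF T])
  have "op_abs T o\<^sub>L op_abs T = cadjoint T o\<^sub>L T"
    using op_powr_add[OF pos, of "1/2" "1/2"] op_powr_one[OF pos] by (simp add: op_abs_def)
  then have "op_abs T (op_abs T x) = cadjoint T (T x)"
    by (metis blinfun_apply_blinfun_compose)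
  moreover have "inner (op_abs T x) (op_abs T x) = inner x (op_abs T (op_abs T x))"
    using positive_op_abs[OF T] by (simp add: positive_op_def self_adjoint_def)
  ultimately have "inner (op_abs T x) (op_abs T x) = inner (T x) (T x)"
    using inner_cadjoint[OF T, of x "T x"] by simp
  then show ?thesis by (simp add: norm_eq_sqrt_inner)
qed

lemma subspace_closure:
  fixes S :: "'a::real_normed_vector set"
  assumes "subspace S"
  shows "subspace (closure S)"
proof (rule subspaceI)
  show "0 \<in> closure S" using subspace_0[OF assms] closure_subset by blast
next
  fix x y assume "x \<in> closure S" "y \<in> closure S"
  then obtain u v where uv: "\<And>n. u n \<in> S" "u \<longlonglongrightarrow> x" "\<And>n. v n \<in> S" "v \<longlonglongrightarrow> y"
    unfolding closure_sequential by blast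
  then have "\<And>n. u n + v n \<in> S" "(\<lambda>n. u n + v n) \<longlonglongrightarrow> x + y"
    by (auto intro: subspace_add[OF assms] tendsto_add)
  then show "x + y \<in> closure S"
    unfolding closure_sequential by (intro exI[of _ "\<lambda>n. u n + v n"]) simp
next
  fix c x assume "x \<in> closure S"
  then obtain u where u: "\<And>n. u n \<in> S" "u \<longlonglongrightarrow> x"
    unfolding closure_sequential by blast
  then have "\<And>n. c *\<^sub>R u n \<in> S" "(\<lambda>n. c *\<^sub>R u n) \<longlonglongrightarrow> c *\<^sub>R x"
    by (auto intro: subspace_scale[OF assms] tendsto_intros)
  then show "c *\<^sub>R x \<in> closure S"
    unfolding closure_sequential by (intro exI[of _ "\<lambda>n. c *\<^sub>R u n"]) simp
qed

lemma self_adjoint_range_ker_decomposition: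
  fixes P :: "'a::{real_inner, complete_space} \<Rightarrow>\<^sub>L 'a"
  assumes "self_adjoint P"
  obtains a where "a \<in> closure (range (blinfun_apply P))" "P (x - a) = 0"
proof -
  have sub: "subspace (closure (range (blinfun_apply P)))"
    by (intro subspace_closure linear_subspace_image subspace_UNIV bounded_linear.linear
        blinfun.bounded_linear_right)
  obtain a where a: "a \<in> closure (range (blinfun_apply P))"
    and ort: "\<And>m. m \<in> closure (range (blinfun_apply P)) \<Longrightarrow> inner (x - a) m = 0"
    using exists_orthogonal_projection[OF sub closed_closure, of x] by blast
  have "inner (x - a) (P (P (x - a))) = 0"
    by (intro ort subsetD[OF closure_subset] rangeI)
  then have "inner (P (x - a)) (P (x - a)) = 0"
    using assms by (simp add: self_adjoint_def)
  then have "P (x - a) = 0" by simp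
  with a show thesis by (rule that)
qed

text \<open>
  The assignment of \<open>T v\<close> to \<open>|T| v\<close> is isometric, so the closure \<open>K\<close> of its graph is the graph of
  an isometry on the closure of the range of \<open>|T|\<close>. The graph of the polar part arises from \<open>K\<close> by
  letting it vanish on \<open>ker |T|\<close>, the orthogonal complement of that closure.
\<close>

lemma polar_decomposition_exists:
  fixes T :: "'a::chilbert_space \<Rightarrow>\<^sub>L 'a"
  assumes T: "complex_linear T"
  obtains U :: "'a \<Rightarrow>\<^sub>L 'a" where "complex_linear U" "partial_isometry U" "U o\<^sub>L op_abs T = T"
    "op_ker U = op_ker (op_abs T)"
proof -
  define P where "P = op_abs T"
  have P_lin: "P (c *\<^sub>C x) = c *\<^sub>C P x" and P_sa: "self_adjoint P" for c x
    using positive_op_abs[OF T] by (auto simp: P_def positive_op_def complex_linear_def)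
  have norm_P: "norm (P x) = norm (T x)" for x unfolding P_def by (rule norm_op_abs[OF T])
  define R where "R = range (\<lambda>v. (P v, T v))"
  define K where "K = closure R"
  have "linear (\<lambda>v. (P v, T v))"
    by (rule linearI) (simp_all add: blinfun.add_right blinfun.scaleR_right)
  then have K_sub: "subspace K"
    unfolding K_def R_def by (intro subspace_closure linear_subspace_image subspace_UNIV)
  have K_iso: "norm a = norm b" if "(a, b) \<in> K" for a b
  proof -
    have "closed {z :: 'a \<times> 'a. norm (fst z) = norm (snd z)}"
      by (intro closed_Collect_eq continuous_intros)
    then have "K \<subseteq> {z. norm (fst z) = norm (snd z)}"
      unfolding K_def by (intro closure_minimal) (auto simp: R_def norm_P)
    with that show ?thesis by auto
  qed
  have K_ort: "inner a c = 0" if "(a, b) \<in> K" "P c = 0" for a b c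
  proof -
    have "inner (P v) c = 0" for v using P_sa \<open>P c = 0\<close> by (simp add: self_adjoint_def)
    moreover have "closed {z :: 'a \<times> 'a. inner (fst z) c = 0}"
      by (intro closed_Collect_eq continuous_intros)
    ultimately have "K \<subseteq> {z. inner (fst z) c = 0}"
      unfolding K_def by (intro closure_minimal) (auto simp: R_def)
    with that show ?thesis by auto
  qed
  have K_scaleC: "(k *\<^sub>C a, k *\<^sub>C b) \<in> K" if "(a, b) \<in> K" for k a b
  proof -
    obtain u where u: "\<And>n. u n \<in> R" "u \<longlonglongrightarrow> (a, b)"
      using \<open>(a, b) \<in> K\<close> unfolding K_def closure_sequential by blast
    have "(k *\<^sub>C fst (u n), k *\<^sub>C snd (u n)) \<in> R" for n
    proof -
      obtain v where "u n = (P v, T v)" using u(1)[of n] by (auto simp: R_def)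
      then have "(k *\<^sub>C fst (u n), k *\<^sub>C snd (u n)) = (P (k *\<^sub>C v), T (k *\<^sub>C v))"
        using T by (simp add: P_lin complex_linear_def)
      then show ?thesis by (auto simp: R_def)
    qed
    moreover have "(\<lambda>n. (k *\<^sub>C fst (u n), k *\<^sub>C snd (u n))) \<longlonglongrightarrow> (k *\<^sub>C a, k *\<^sub>C b)"
      using tendsto_fst[OF u(2)] tendsto_snd[OF u(2)]
      by (intro tendsto_Pair bounded_linear.tendsto[OF bounded_linear_scaleC]) auto
    ultimately show ?thesis
      unfolding K_def closure_sequential
      by (intro exI[of _ "\<lambda>n. (k *\<^sub>C fst (u n), k *\<^sub>C snd (u n))"]) simp
  qed
  have K_dom: "\<exists>b. (a, b) \<in> K" if "a \<in> closure (range (blinfun_apply P))" for a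
  proof -
    have "complete K" by (simp add: K_def complete_eq_closed)
    \<comment> \<open>The first projection is bounded below on \<open>K\<close>, so its image is complete.\<close>
    moreover have "(1/2) * norm z \<le> norm (fst z)" if "z \<in> K" for z
    proof -
      have "norm z \<le> norm (fst z) + norm (snd z)"
        using norm_Pair_le[of "fst z" "snd z"] by simp
      then show ?thesis using K_iso[of "fst z" "snd z"] that by simp
    qed
    ultimately have "complete (fst ` K)"
      using complete_isometric_image[of "1/2" K fst] K_sub bounded_linear_fst by auto
    then have "closed (fst ` K)" by (rule complete_imp_closed)
    moreover have "range (blinfun_apply P) \<subseteq> fst ` K"
      using closure_subset[of R] by (force simp: K_def R_def image_iff)
    ultimately have "closure (range (blinfun_apply P)) \<subseteq> fst ` K" by (intro closure_minimal)
    with that show ?thesis by force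
  qed
  define G where "G = {(a + c, b) | a b c. (a, b) \<in> K \<and> P c = 0}"
  have G_I: "(a + c, b) \<in> G" if "(a, b) \<in> K" "P c = 0" for a b c
    using that by (auto simp: G_def)
  have G_E: "\<exists>a c. x = a + c \<and> (a, y) \<in> K \<and> P c = 0" if "(x, y) \<in> G" for x y
    using that by (auto simp: G_def)
  have "subspace G"
  proof (rule subspaceI)
    show "0 \<in> G" using G_I[of 0 0 0] subspace_0[OF K_sub] by (simp add: zero_prod_def)
  next
    fix z w assume "z \<in> G" "w \<in> G"
    then obtain a b c a' b' c' where "z = (a + c, b)" "(a, b) \<in> K" "P c = 0"
      and "w = (a' + c', b')" "(a', b') \<in> K" "P c' = 0"
      unfolding G_def by blast
    then show "z + w \<in> G"
      using G_I[of "a + a'" "b + b'" "c + c'"] subspace_add[OF K_sub, of "(a, b)" "(a', b')"]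
      by (simp add: blinfun.add_right algebra_simps)
  next
    fix r z assume "z \<in> G"
    then obtain a b c where "z = (a + c, b)" "(a, b) \<in> K" "P c = 0"
      unfolding G_def by blast
    then show "r *\<^sub>R z \<in> G"
      using G_I[of "r *\<^sub>R a" "r *\<^sub>R b" "r *\<^sub>R c"] subspace_scale[OF K_sub, of "(a, b)" r]
      by (simp add: blinfun.scaleR_right scaleR_add_right)
  qed
  moreover have "\<exists>y. (x, y) \<in> G" for x
  proof -
    obtain a where "a \<in> closure (range (blinfun_apply P))" and c: "P (x - a) = 0"
      using self_adjoint_range_ker_decomposition[OF P_sa] by metis
    then obtain b where "(a, b) \<in> K" using K_dom by blast
    from G_I[OF this c] show ?thesis by auto
  qed
  moreover have "norm y \<le> 1 * norm x" if "(x, y) \<in> G" for x y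
  proof -
    obtain a c where x: "x = a + c" and K: "(a, y) \<in> K" and c: "P c = 0"
      using G_E[OF \<open>(x, y) \<in> G\<close>] by blast
    have "(norm y)\<^sup>2 \<le> (norm x)\<^sup>2"
      using K_iso[OF K] K_ort[OF K c]
      by (simp add: x power2_norm_eq_inner inner_add_left inner_add_right inner_commute)
        (simp add: power2_norm_eq_inner[symmetric])
    from power2_le_imp_le[OF this norm_ge_zero] show ?thesis by simp
  qed
  ultimately obtain U :: "'a \<Rightarrow>\<^sub>L 'a" where U: "\<And>x y. (x, y) \<in> G \<longleftrightarrow> U x = y"
    using blinfun_of_graph[of G 1] by blast
  have U_lin: "U (k *\<^sub>C x) = k *\<^sub>C U x" for k x
  proof -
    obtain a c where x: "x = a + c" and K: "(a, U x) \<in> K" and c: "P c = 0"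
      using G_E[of x "U x"] U[of x "U x"] by blast
    have "(k *\<^sub>C a + k *\<^sub>C c, k *\<^sub>C U x) \<in> G"
      using G_I[OF K_scaleC[OF K]] c by (simp add: P_lin)
    then show ?thesis by (simp add: U x scaleC_add_right)
  qed
  have UP: "U o\<^sub>L P = T"
  proof (rule blinfun_eqI)
    fix v
    have "(P v, T v) \<in> K" using closure_subset[of R] by (auto simp: K_def R_def)
    from G_I[OF this, of 0] show "(U o\<^sub>L P) v = T v" by (simp add: U)
  qed
  have ker: "U x = 0 \<longleftrightarrow> P x = 0" for x
  proof
    assume "U x = 0"
    then obtain a c where "x = a + c" "(a, 0) \<in> K" "P c = 0"
      using G_E[of x 0] U by blast
    then show "P x = 0" using K_iso[of a 0] by simp
  next
    assume "P x = 0"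
    then have "(0 + x, 0) \<in> G"
      using subspace_0[OF K_sub] by (intro G_I) (simp_all add: zero_prod_def)
    then show "U x = 0" by (simp add: U)
  qed
  have iso: "partial_isometry U"
    unfolding partial_isometry_def
  proof (intro allI impI)
    fix x assume x: "\<forall>y\<in>op_ker U. cinner x y = 0"
    obtain a c where ac: "x = a + c" and K: "(a, U x) \<in> K" and c: "P c = 0"
      using G_E[of x "U x"] U[of x "U x"] by blast
    have "inner x c = 0" using x c ker by (simp add: op_ker_def inner_eq_Re_cinner)
    moreover have "inner a c = 0" by (rule K_ort[OF K c])
    ultimately have "c = 0" by (simp add: ac inner_add_left)
    then show "norm (U x) = norm x" using K_iso[OF K] by (simp add: ac)
  qed
  show thesis
  proof (rule that)
    show "complex_linear U" using U_lin by (simp only: complex_linear_def simp_thms)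
    show "partial_isometry U" by (rule iso)
    show "U o\<^sub>L op_abs T = T" using UP unfolding P_def .
    show "op_ker U = op_ker (op_abs T)" unfolding op_ker_def P_def[symmetric] by (simp only: ker)
  qed
qed

text \<open>
  Both operators are determined on the range of \<open>P\<close>, hence on its closure, and vanish on \<open>ker P\<close>; these
  two subspaces span the whole space.
\<close>

lemma polar_decomposition_unique:
  fixes P U V :: "'a::{real_inner, complete_space} \<Rightarrow>\<^sub>L 'a"
  assumes "self_adjoint P" and eq: "U o\<^sub>L P = V o\<^sub>L P"
    and ker: "op_ker U = op_ker P" "op_ker V = op_ker P"
  shows "U = V"
proof (rule blinfun_eqI)
  fix x
  have "U (P v) = V (P v)" for v
    using arg_cong[OF eq, of "\<lambda>S. blinfun_apply S v"] by simp
  moreover have "closed {a. U a = V a}"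
    by (intro closed_Collect_eq continuous_intros)
  ultimately have cl: "closure (range (blinfun_apply P)) \<subseteq> {a. U a = V a}"
    by (intro closure_minimal) auto
  obtain a where a: "a \<in> closure (range (blinfun_apply P))" "P (x - a) = 0"
    using self_adjoint_range_ker_decomposition[OF assms(1)] by metis
  then have "x - a \<in> op_ker U" "x - a \<in> op_ker V" by (simp_all add: ker) (simp_all add: op_ker_def)
  then have "U x = U a" "V x = V a" by (simp_all add: op_ker_def blinfun.diff_right)
  moreover have "U a = V a" using cl a(1) by blast
  ultimately show "U x = V x" by (simp only:)
qed

lemma polar_decomposition:
  fixes T :: "'a::chilbert_space \<Rightarrow>\<^sub>L 'a"
  assumes T: "complex_linear T"
  shows "polar_part T o\<^sub>L op_abs T = T"
proof -
  let ?polar = "\<lambda>U :: 'a \<Rightarrow>\<^sub>L 'a. complex_linear U \<and> partial_isometry U \<and> T = U o\<^sub>L op_abs T \<and>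
    op_ker U = op_ker (op_abs T) \<and> op_ker (op_abs T) = op_ker T"
  have "op_abs T x = 0 \<longleftrightarrow> T x = 0" for x
    using norm_op_abs[OF T, of x] by auto
  then have ker: "op_ker (op_abs T) = op_ker T"
    by (simp add: op_ker_def)
  have sa: "self_adjoint (op_abs T)"
    using positive_op_abs[OF T] by (simp add: positive_op_def)
  obtain U :: "'a \<Rightarrow>\<^sub>L 'a" where "complex_linear U" "partial_isometry U" "U o\<^sub>L op_abs T = T"
    "op_ker U = op_ker (op_abs T)"
    by (rule polar_decomposition_exists[OF T])
  with ker have U: "?polar U" by (intro conjI) (assumption | rule sym)+
  have "?polar (polar_part T)"
    unfolding polar_part_def
  proof (rule theI)
    show "?polar U" by (rule U)
    show "V = U" if V: "?polar V" for V
    proof (rule polar_decomposition_unique[OF sa])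
      have "T = V o\<^sub>L op_abs T" using V by (elim conjE)
      moreover have "T = U o\<^sub>L op_abs T" using U by (elim conjE)
      ultimately show "V o\<^sub>L op_abs T = U o\<^sub>L op_abs T" by (rule trans[OF sym])
      show "op_ker V = op_ker (op_abs T)" using V by blast
      show "op_ker U = op_ker (op_abs T)" using U by blast
    qed
  qed
  then show ?thesis by (elim conjE) (rule sym)
qed

section \<open>The Aluthge transform\<close>

theorem proposition2p5:
  fixes T :: "'a::chilbert_space \<Rightarrow>\<^sub>L 'a" and l :: real
  assumes "complex_linear T" and "0 < l" and "l < 1"
  shows "quasi_hyperbolic T \<longleftrightarrow> quasi_hyperbolic (aluthge l T)"
proof -
  have compose_assoc: "(X o\<^sub>L Y) o\<^sub>L Z = X o\<^sub>L (Y o\<^sub>L Z)" for X Y Z :: "'a \<Rightarrow>\<^sub>L 'a"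
    by (rule blinfun_eqI) simp
  define A where "A = op_powr (op_abs T) l"
  define B where "B = polar_part T o\<^sub>L op_powr (op_abs T) (1 - l)"
  have pos: "positive_op (op_abs T)" by (rule positive_op_abs[OF assms(1)])
  have "op_powr (op_abs T) (1 - l) o\<^sub>L A = op_abs T"
    using op_powr_add[OF pos, of "1 - l" l] op_powr_one[OF pos] assms(2,3) by (simp add: A_def)
  then have "polar_part T o\<^sub>L (op_powr (op_abs T) (1 - l) o\<^sub>L A) = T"
    using polar_decomposition[OF assms(1)] by simp
  then have T: "B o\<^sub>L A = T"
    by (simp add: B_def compose_assoc)
  have \<Delta>: "A o\<^sub>L B = aluthge l T"
    by (simp add: aluthge_def A_def B_def compose_assoc)
  show ?thesis
    using quasi_hyperbolic_swap[of A B] quasi_hyperbolic_swap[of B A] unfolding \<Delta> T by blast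
qed

end
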